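(* Let $X$ be a finite set with $|X|\ge 3$ and let $\mathfrak D$ be a non-empty family of (full) choice functions for $\binom X2$ which is closed under permutations of $X$. Then the following conditions are equivalent: (A) for every choice function $c$ on $\binom X2$ there are a finite set $J$ and $c_j\in\mathfrak D$ for $j\in J$ such that for all $x\ne y\in X$: $$c\{x,y\}=y \iff \frac{|J|}{2}<|\{j\in J: c_j\{x,y\}=y\}|;$$ (B) there are $c\in\mathfrak D$ and $x\in X$ such that $|\{y\in X\setminus\{x\}: c\{x,y\}=y\}|\ne (|X|-1)/2$.
   Context: $\binom X2$ is the set of two-element subsets of $X$. A (full) choice function for $\binom X2$ is a function $c$ with domain $\binom X2$ such that $c\{x,y\}\in\{x,y\}$ for all $x\ne y$. For a permutation $\pi$ of $X$ and a choice function $c$, $c^\pi$ is the choice function with $c^\pi\{\pi(x),\pi(y)\}=\pi(c\{x,y\})$; $\mathfrak D$ closed under permutations means $c\in\mathfrak D\Rightarrow c^\pi\in\mathfrak D$ for every permutation $\pi$ of $X$. *)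

theory Defs
  imports Complex_Main "HOL-Library.FuncSet" "HOL-Library.Ramsey" "HOL-Combinatorics.Permutations"
begin

(* nsets X 2, written [X]\<^bsup>2\<^esup>, is the set of two-element subsets of X.  Choice functions are
   extensional, so that equality of HOL functions is equality of functions with domain [X]\<^bsup>2\<^esup>. *)
definition choice_functions :: "'a set \<Rightarrow> ('a set \<Rightarrow> 'a) set" where
  "choice_functions X = (\<Pi>\<^sub>E P\<in>[X]\<^bsup>2\<^esup>. P)"

definition perm_choice :: "'a set \<Rightarrow> ('a \<Rightarrow> 'a) \<Rightarrow> ('a set \<Rightarrow> 'a) \<Rightarrow> ('a set \<Rightarrow> 'a)" where
  "perm_choice X \<pi> c = (\<lambda>P\<in>[X]\<^bsup>2\<^esup>. \<pi> (c (inv \<pi> ` P)))"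

definition closed_under_permutations :: "'a set \<Rightarrow> ('a set \<Rightarrow> 'a) set \<Rightarrow> bool" where
  "closed_under_permutations X D \<longleftrightarrow> (\<forall>c\<in>D. \<forall>\<pi>. \<pi> permutes X \<longrightarrow> perm_choice X \<pi> c \<in> D)"

lemma perm_choice_apply:
  assumes "\<pi> permutes X" "x \<in> X" "y \<in> X" "x \<noteq> y"
  shows "perm_choice X \<pi> c {\<pi> x, \<pi> y} = \<pi> (c {x, y})"
proof -
  have "\<pi> x \<noteq> \<pi> y"
    using permutes_inj[OF assms(1)] assms(4) by (auto dest: injD)
  then have "{\<pi> x, \<pi> y} \<in> [X]\<^bsup>2\<^esup>"
    using assms by (auto simp: nsets_def permutes_in_image)
  then show ?thesis
    using permutes_inverses(2)[OF assms(1)] by (simp add: perm_choice_def)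
qed

lemma perm_choice_in_choice_functions:
  assumes "\<pi> permutes X" "c \<in> choice_functions X"
  shows "perm_choice X \<pi> c \<in> choice_functions X"
  unfolding choice_functions_def
proof (rule PiE_I)
  fix P assume P: "P \<in> [X]\<^bsup>2\<^esup>"
  have inv: "inv \<pi> permutes X"
    by (rule permutes_inv[OF assms(1)])
  have "inv \<pi> ` P \<in> [X]\<^bsup>2\<^esup>"
    using P permutes_in_image[OF inv] inj_on_subset[OF permutes_inj[OF inv]]
    by (auto simp: nsets_def card_image)
  then have "c (inv \<pi> ` P) \<in> inv \<pi> ` P"
    using assms(2) by (auto simp: choice_functions_def PiE_def Pi_def)
  then have "\<pi> (c (inv \<pi> ` P)) \<in> P"
    using permutes_inverses(1)[OF assms(1)] by auto
  then show "perm_choice X \<pi> c P \<in> P"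
    using P by (simp add: perm_choice_def)
qed (simp add: perm_choice_def)

end

theory Submission
  imports Defs
begin

text \<open>Identify a choice function \<open>c\<close> with the skew-symmetric sign matrix \<open>f\<close> that has
  \<open>f x y = 1\<close> iff \<open>c {x, y} = y\<close>. A majority vote is the sign of a sum of such matrices. Summing a matrix
  over all permutations gives \<open>0\<close>, so the sums of members of \<open>D\<close> form a group \<open>G\<close>. For fixed \<open>p \<noteq> q\<close>,
  subtract from a member of \<open>G\<close> its image under the transposition of \<open>p\<close> and \<open>q\<close> and average over the
  permutations of \<open>X - {p, q}\<close>: only a combination of two matrices remains, the single arc from
  \<open>p\<close> to \<open>q\<close> and the difference of the stars at \<open>p\<close> and \<open>q\<close>, and the ratio of the
  coefficients depends on the difference of the scores (row sums) at \<open>p\<close> and \<open>q\<close>. Two arcs with different score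
  differences therefore yield a nonzero multiple of a single arc, and then \<open>G\<close> contains matrices
  of every sign pattern. If all arcs had the same score difference \<open>k\<close>, going round a triangle would give
  an odd multiple of \<open>k\<close> equal to \<open>0\<close>, so all scores would be equal, hence \<open>0\<close>: the balanced case.\<close>

section \<open>Skew-symmetric matrices\<close>

text \<open>Entries outside \<open>X\<close> are fixed to 0 so that matrices can be compared as
  functions on the whole type. Skew-symmetry carries the condition on rows over to columns.\<close>

definition skew_on :: "'a set \<Rightarrow> ('a \<Rightarrow> 'a \<Rightarrow> int) \<Rightarrow> bool" where
  "skew_on X f \<longleftrightarrow> (\<forall>x y. f x y + f y x = 0) \<and> (\<forall>x y. x \<notin> X \<longrightarrow> f x y = 0)"

definition score :: "'a set \<Rightarrow> ('a \<Rightarrow> 'a \<Rightarrow> int) \<Rightarrow> 'a \<Rightarrow> int" where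
  "score X f x = (\<Sum>y\<in>X. f x y)"

definition arc :: "'a \<Rightarrow> 'a \<Rightarrow> 'a \<Rightarrow> 'a \<Rightarrow> int" where
  "arc p q x y = of_bool (x = p \<and> y = q) - of_bool (x = q \<and> y = p)"

text \<open>The arc between \<open>p\<close> and \<open>q\<close> is left out, so
  \<open>star_diff X p q\<close> and \<open>arc p q\<close> have disjoint supports.\<close>

definition star_diff :: "'a set \<Rightarrow> 'a \<Rightarrow> 'a \<Rightarrow> 'a \<Rightarrow> 'a \<Rightarrow> int" where
  "star_diff X p q x y = (\<Sum>z\<in>X - {p, q}. arc p z x y - arc q z x y)"

lemma skew_onD:
  assumes "skew_on X f"
  shows "f x y = - f y x" "x \<notin> X \<or> y \<notin> X \<Longrightarrow> f x y = 0" "f x x = 0"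
proof -
  have s: "u + v = 0 \<Longrightarrow> u = - v" for u v :: int
    by simp
  have skew: "f x y = - f y x" for x y
    using assms by (intro s) (simp add: skew_on_def)
  show "f x y = - f y x" by (rule skew)
  show "f x x = 0" using skew[of x x] by simp
  have out: "f x y = 0" if "x \<notin> X" for x y
    using assms that by (simp add: skew_on_def)
  show "f x y = 0" if "x \<notin> X \<or> y \<notin> X"
    using that out[of x y] out[of y x] skew[of x y] by auto
qed

lemma skew_on_zero: "skew_on X (\<lambda>x y. 0)"
  by (simp add: skew_on_def)

lemma skew_on_add:
  assumes "skew_on X f" "skew_on X g"
  shows "skew_on X (\<lambda>x y. f x y + g x y)"
  unfolding skew_on_def
proof (intro conjI allI impI)
  show "f x y + g x y + (f y x + g y x) = 0" for x y
    using skew_onD(1)[OF assms(1), of x y] skew_onD(1)[OF assms(2), of x y] by simp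
  show "f x y + g x y = 0" if "x \<notin> X" for x y
    using that by (simp add: skew_onD(2)[OF assms(1)] skew_onD(2)[OF assms(2)])
qed

text \<open>Exchanging the two summations shows that the total equals its own negative.\<close>

lemma sum_score:
  assumes "skew_on X f"
  shows "(\<Sum>x\<in>X. score X f x) = 0"
proof -
  have "(\<Sum>x\<in>X. score X f x) = (\<Sum>x\<in>X. \<Sum>y\<in>X. - f y x)"
    unfolding score_def by (intro sum.cong refl skew_onD(1)[OF assms])
  also have "\<dots> = - (\<Sum>x\<in>X. \<Sum>y\<in>X. f y x)"
    by (simp add: sum_negf)
  also have "(\<Sum>x\<in>X. \<Sum>y\<in>X. f y x) = (\<Sum>x\<in>X. score X f x)"
    unfolding score_def by (rule sum.swap)
  finally show ?thesis by simp
qed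

text \<open>Each sum over \<open>z\<close> has at most one nonzero term; the resulting closed form
  can be evaluated entry by entry.\<close>

lemma star_diff_eq:
  assumes "finite X" "p \<noteq> q"
  shows "star_diff X p q x y =
    of_bool (y \<in> X - {p, q}) * (of_bool (x = p) - of_bool (x = q)) -
    of_bool (x \<in> X - {p, q}) * (of_bool (y = p) - of_bool (y = q))"
proof -
  have *: "(\<Sum>z\<in>X - {p, q}. of_bool (u = r \<and> v = z)) = (of_bool (v \<in> X - {p, q} \<and> u = r) :: int)"
    for u v r
  proof (cases "u = r")
    case True
    have "(\<Sum>z\<in>X - {p, q}. of_bool (v = z)) = (\<Sum>z\<in>X - {p, q}. if v = z then 1 else (0::int))"
      by (intro sum.cong) auto
    then show ?thesis using True assms(1) by (simp add: sum.delta')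
  qed simp
  have "star_diff X p q x y = (\<Sum>z\<in>X - {p, q}. of_bool (x = p \<and> y = z)) -
     (\<Sum>z\<in>X - {p, q}. of_bool (y = p \<and> x = z)) - ((\<Sum>z\<in>X - {p, q}. of_bool (x = q \<and> y = z)) -
     (\<Sum>z\<in>X - {p, q}. of_bool (y = q \<and> x = z)))"
    unfolding star_diff_def arc_def by (simp add: sum_subtractf conj_commute)
  then show ?thesis
    unfolding * using assms(2) by auto
qed

text \<open>Double transitivity: first move \<open>p\<close> to \<open>a\<close>, which takes
  \<open>q\<close> to some \<open>r\<close> different from \<open>a\<close>; then swapping
  \<open>r\<close> with \<open>b\<close> leaves \<open>a\<close> in place.\<close>

lemma ex_permutes_pair:
  assumes "a \<in> X" "b \<in> X" "a \<noteq> b" "p \<in> X" "q \<in> X" "p \<noteq> q"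
  obtains \<sigma> where "\<sigma> permutes X" "\<sigma> p = a" "\<sigma> q = b"
proof -
  define r where "r = transpose p a q"
  have r: "r \<in> X" "r \<noteq> a"
    using assms by (auto simp: r_def transpose_def)
  have "(transpose r b \<circ> transpose p a) permutes X"
    using assms r by (intro permutes_compose permutes_swap_id)
  moreover have "(transpose r b \<circ> transpose p a) p = a" "(transpose r b \<circ> transpose p a) q = b"
    using r assms by (auto simp: r_def[symmetric])
  ultimately show ?thesis using that by blast
qed

text \<open>By symmetry the sum over permutations does not depend on \<open>z\<close>, and for each
  permutation the values over all of \<open>Y\<close> add up to the full sum of \<open>g\<close>.
  The factor \<open>card Y\<close> avoids a division in the integers.\<close>

lemma sum_permutations_apply_const:
  fixes g :: "'a \<Rightarrow> int"
  assumes "finite Y" "z \<in> Y"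
  shows "int (card Y) * (\<Sum>\<pi> | \<pi> permutes Y. g (\<pi> z)) = fact (card Y) * (\<Sum>y\<in>Y. g y)"
proof -
  have const: "(\<Sum>\<pi> | \<pi> permutes Y. g (\<pi> y)) = (\<Sum>\<pi> | \<pi> permutes Y. g (\<pi> z))" if "y \<in> Y" for y
    using sum_permutations_compose_right[OF permutes_swap_id[OF assms(2) that], of "\<lambda>\<pi>. g (\<pi> z)"]
    by simp
  have "int (card Y) * (\<Sum>\<pi> | \<pi> permutes Y. g (\<pi> z)) = (\<Sum>y\<in>Y. \<Sum>\<pi> | \<pi> permutes Y. g (\<pi> y))"
    using const by simp
  also have "\<dots> = (\<Sum>\<pi> | \<pi> permutes Y. \<Sum>y\<in>Y. g (\<pi> y))"
    by (rule sum.swap)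
  also have "\<dots> = (\<Sum>\<pi> | \<pi> permutes Y. \<Sum>y\<in>Y. g y)"
    by (intro sum.cong refl sum.reindex_bij_betw) (simp add: permutes_imp_bij)
  also have "\<dots> = fact (card Y) * (\<Sum>y\<in>Y. g y)"
    by (simp add: card_permutations[OF refl assms(1)])
  finally show ?thesis .
qed

lemma ex_arcs_score_diff:
  assumes skew: "skew_on X f"
    and sgn: "\<And>x y. x \<in> X \<Longrightarrow> y \<in> X \<Longrightarrow> x \<noteq> y \<Longrightarrow> f x y = 1 \<or> f x y = - 1"
    and "card X \<ge> 3" and x0: "x0 \<in> X" "score X f x0 \<noteq> 0"
  obtains a b a' b' where "a \<in> X" "b \<in> X" "f a b = 1" "a' \<in> X" "b' \<in> X" "f a' b' = 1"
    "score X f a - score X f b \<noteq> score X f a' - score X f b'"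
proof (rule ccontr)
  let ?s = "score X f"
  note witness = that
  assume "\<not> thesis"
  then have same: "?s a - ?s b = ?s a' - ?s b'"
    if "a \<in> X" "b \<in> X" "f a b = 1" "a' \<in> X" "b' \<in> X" "f a' b' = 1" for a b a' b'
    using that witness by blast
  obtain x y z where xyz: "x \<in> X" "y \<in> X" "z \<in> X" "x \<noteq> y" "y \<noteq> z" "z \<noteq> x"
  proof -
    obtain S where "S \<subseteq> X" "card S = 3"
      using obtain_subset_with_card_n[OF \<open>card X \<ge> 3\<close>] by auto
    then show thesis
      using that by (auto simp: card_3_iff)
  qed
  obtain a b where ab: "a \<in> X" "b \<in> X" "f a b = 1"
    using sgn[OF xyz(1,2,4)] skew_onD(1)[OF skew, of x y] xyz by force
  define k where "k = ?s a - ?s b"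
  \<comment> \<open>If all arcs share the score difference \<open>k\<close>, reversing an arc
    changes the sign on both sides.\<close>
  have k: "?s u - ?s v = k * f u v" if "u \<in> X" "v \<in> X" for u v
  proof (cases "u = v")
    case True
    then show ?thesis by (simp add: skew_onD(3)[OF skew])
  next
    case False
    from sgn[OF that False] show ?thesis
    proof
      assume "f u v = 1"
      then show ?thesis using same[OF that _ ab] by (simp add: k_def)
    next
      assume m: "f u v = - 1"
      then have "f v u = 1" using skew_onD(1)[OF skew, of v u] by simp
      then show ?thesis using same[OF that(2,1) _ ab] m by (simp add: k_def)
    qed
  qed
  \<comment> \<open>The score differences telescope to 0 round the triangle, while a sum of three
    signs is odd.\<close>
  have "k * (f x y + f y z + f z x) = 0"
    using k[OF xyz(1,2)] k[OF xyz(2,3)] k[OF xyz(3,1)] by (simp add: distrib_left)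
  moreover have "f x y + f y z + f z x \<noteq> 0"
    using sgn[of x y] sgn[of y z] sgn[of z x] xyz by auto
  ultimately have "k = 0" by simp
  then have "?s u = ?s x0" if "u \<in> X" for u
    using k[OF that x0(1)] by simp
  \<comment> \<open>All scores equal the one at \<open>x0\<close>, and together they sum to
    0.\<close>
  then have "int (card X) * ?s x0 = 0"
    using sum_score[OF skew] by simp
  then show False using x0 \<open>card X \<ge> 3\<close> by simp
qed

section \<open>Permutation-invariant groups of skew-symmetric matrices\<close>

locale invariant_group =
  fixes X :: "'a set" and G :: "('a \<Rightarrow> 'a \<Rightarrow> int) set"
  assumes finite_X: "finite X"
    and skew: "f \<in> G \<Longrightarrow> skew_on X f"
    and zero_in: "(\<lambda>x y. 0) \<in> G"
    and add_in: "f \<in> G \<Longrightarrow> g \<in> G \<Longrightarrow> (\<lambda>x y. f x y + g x y) \<in> G"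
    and neg_in: "f \<in> G \<Longrightarrow> (\<lambda>x y. - f x y) \<in> G"
    and perm_in: "f \<in> G \<Longrightarrow> \<pi> permutes X \<Longrightarrow> (\<lambda>x y. f (\<pi> x) (\<pi> y)) \<in> G"
begin

lemma diff_in: "f \<in> G \<Longrightarrow> g \<in> G \<Longrightarrow> (\<lambda>x y. f x y - g x y) \<in> G"
  using add_in[OF _ neg_in, of f g] by simp

lemma sum_in:
  assumes "\<And>i. i \<in> I \<Longrightarrow> F i \<in> G"
  shows "(\<lambda>x y. \<Sum>i\<in>I. F i x y) \<in> G"
  using assms by (induction I rule: infinite_finite_induct) (simp_all add: zero_in add_in)

lemma nat_mult_in:
  assumes "f \<in> G"
  shows "(\<lambda>x y. int n * f x y) \<in> G"
  using sum_in[of "{..<n}" "\<lambda>_. f"] assms by simp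

lemma int_mult_in:
  assumes "f \<in> G"
  shows "(\<lambda>x y. k * f x y) \<in> G"
  using nat_mult_in[OF assms, of "nat k"] nat_mult_in[OF neg_in[OF assms], of "nat (- k)"]
  by (cases "k \<ge> 0") simp_all

text \<open>The matrix \<open>u\<close>, which is \<open>f\<close> minus its image under the
  transposition, changes sign when \<open>p\<close> and \<open>q\<close> are swapped. Summing over
  the permutations of the remaining \<open>m\<close> points makes its entries from \<open>p\<close>,
  and those from \<open>q\<close>, to these points constant. No division is made, hence the factors
  \<open>fact m\<close>.\<close>

lemma antisymmetrize_average:
  assumes f: "f \<in> G" and pq: "p \<in> X" "q \<in> X" "p \<noteq> q" and "card X \<ge> 3"
  defines "m \<equiv> card X - 2"
  obtains g where "(\<lambda>x y. 2 * fact m * f p q * arc p q x y + g * star_diff X p q x y) \<in> G"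
    and "int m * g = fact m * (score X f p - score X f q - 2 * f p q)"
proof -
  define Y where "Y = X - {p, q}"
  define \<tau> where "\<tau> = transpose p q"
  define u where "u x y = f x y - f (\<tau> x) (\<tau> y)" for x y
  define h where "h x y = (\<Sum>\<pi> | \<pi> permutes Y. u (\<pi> x) (\<pi> y))" for x y
  have Y: "finite Y" "card Y = m" "p \<notin> Y" "q \<notin> Y" "Y \<subseteq> X"
    using finite_X pq by (auto simp: Y_def m_def card_Diff_subset)
  have "Y \<noteq> {}" using Y(2) \<open>card X \<ge> 3\<close> by (auto simp: m_def)
  then obtain z0 where z0: "z0 \<in> Y" by blast
  have "\<tau> permutes X"
    unfolding \<tau>_def using pq by (intro permutes_swap_id)
  then have u: "u \<in> G"
    unfolding u_def by (rule diff_in[OF f perm_in[OF f]])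
  have h: "h \<in> G"
    unfolding h_def
  proof (rule sum_in[of _ "\<lambda>\<pi> x y. u (\<pi> x) (\<pi> y)"])
    show "(\<lambda>x y. u (\<pi> x) (\<pi> y)) \<in> G" if "\<pi> \<in> {\<pi>. \<pi> permutes Y}" for \<pi>
      using that Y(5) by (intro perm_in[OF u]) (auto intro: permutes_subset)
  qed
  note sk = skew_onD[OF skew[OF h]] and skf = skew_onD[OF skew[OF f]]
  \<comment> \<open>For \<open>z\<close> in \<open>Y\<close>, \<open>d z\<close> is the entry of
    \<open>u\<close> at \<open>(p, z)\<close>, and \<open>- d z\<close> the entry at
    \<open>(q, z)\<close>.\<close>
  define d where "d z = f p z - f q z" for z
  define g where "g = (\<Sum>\<pi> | \<pi> permutes Y. d (\<pi> z0))"
  have fixed: "\<pi> p = p" "\<pi> q = q" if "\<pi> permutes Y" for \<pi>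
    using that Y by (auto simp: permutes_not_in)
  have tauY: "\<tau> z = z" if "z \<in> Y" for z
    using that Y by (auto simp: \<tau>_def transpose_def)
  have tau: "\<tau> p = q" "\<tau> q = p"
    by (simp_all add: \<tau>_def)
  have inY: "\<pi> z \<in> Y" if "\<pi> permutes Y" "z \<in> Y" for \<pi> z
    using that by (simp add: permutes_in_image)
  have mg: "int m * (\<Sum>\<pi> | \<pi> permutes Y. d (\<pi> z)) = fact m * (\<Sum>z\<in>Y. d z)" if "z \<in> Y" for z
    using sum_permutations_apply_const[OF Y(1) that, of d] Y(2) by simp
  \<comment> \<open>Since \<open>m\<close> is positive it can be cancelled, so the sum has the same
    value \<open>g\<close> at every point of \<open>Y\<close>.\<close>
  have "m > 0" using \<open>card X \<ge> 3\<close> by (simp add: m_def)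
  then have const: "(\<Sum>\<pi> | \<pi> permutes Y. d (\<pi> z)) = g" if "z \<in> Y" for z
    using mg[OF that] mg[OF z0] unfolding g_def by (metis mult_cancel_left of_nat_eq_0_iff less_not_refl)
  \<comment> \<open>Permutations of \<open>Y\<close> fix \<open>p\<close> and \<open>q\<close>, so
    all \<open>fact m\<close> summands equal \<open>f p q - f q p\<close>.\<close>
  have hpq: "h p q = 2 * fact m * f p q"
  proof -
    have "h p q = (\<Sum>\<pi> | \<pi> permutes Y. 2 * f p q)"
      unfolding h_def using skf(1)[of q p]
      by (intro sum.cong refl) (simp add: u_def fixed tau)
    then show ?thesis by (simp add: card_permutations[OF Y(2,1)])
  qed
  have hpz: "h p z = g" if "z \<in> Y" for z
    unfolding const[OF that, symmetric] h_def
    by (intro sum.cong refl) (simp add: u_def fixed tau tauY inY that d_def)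
  have hqz: "h q z = - g" if "z \<in> Y" for z
    unfolding const[OF that, symmetric] h_def sum_negf[symmetric]
    by (intro sum.cong refl) (simp add: u_def fixed tau tauY inY that d_def)
  \<comment> \<open>The transposition fixes \<open>Y\<close> pointwise, so \<open>u\<close> vanishes
    between points of \<open>Y\<close>.\<close>
  have hzw: "h z w = 0" if "z \<in> Y" "w \<in> Y" for z w
    unfolding h_def
    by (intro sum.neutral ballI) (simp add: u_def tauY inY that)
  have "h x y = 2 * fact m * f p q * arc p q x y + g * star_diff X p q x y" for x y
  proof (cases "x \<in> X \<and> y \<in> X")
    case True
    then have "x = p \<or> x = q \<or> x \<in> Y" "y = p \<or> y = q \<or> y \<in> Y"
      by (auto simp: Y_def)
    moreover have "h q p = - (2 * fact m * f p q)" "h z p = - g" "h z q = g" if "z \<in> Y" for z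
      using sk(1)[of q p] sk(1)[of z p] sk(1)[of z q] hpq hpz[OF that] hqz[OF that] by simp_all
    moreover have "z \<noteq> p" "z \<noteq> q" if "z \<in> Y" for z
      using that Y by auto
    ultimately show ?thesis
      using pq(3) hpq hpz hqz hzw sk(3) Y(3,4) z0
      unfolding star_diff_eq[OF finite_X pq(3)] arc_def Y_def[symmetric]
      by (elim disjE) simp_all
  next
    case False
    then have "h x y = 0" "arc p q x y = 0" "star_diff X p q x y = 0"
      using sk(2)[of x y] pq by (auto simp: arc_def star_diff_eq[OF finite_X pq(3)])
    then show ?thesis by simp
  qed
  then have "h = (\<lambda>x y. 2 * fact m * f p q * arc p q x y + g * star_diff X p q x y)"
    by (intro ext)
  with h have "(\<lambda>x y. 2 * fact m * f p q * arc p q x y + g * star_diff X p q x y) \<in> G"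
    by simp
  moreover have "score X f v = f v p + f v q + (\<Sum>z\<in>Y. f v z)" for v
  proof -
    have "X = insert p (insert q Y)" using pq by (auto simp: Y_def)
    then have "score X f v = (\<Sum>z\<in>insert p (insert q Y). f v z)"
      by (simp add: score_def)
    then show ?thesis using Y pq by simp
  qed
  \<comment> \<open>The entries at \<open>(p, q)\<close> and \<open>(q, p)\<close> account for the
    \<open>2 * f p q\<close> in the score difference.\<close>
  then have "score X f p - score X f q - 2 * f p q = (\<Sum>z\<in>Y. d z)"
    using skf(1)[of q p] skf(3) by (simp add: d_def sum_subtractf)
  then have "int m * g = fact m * (score X f p - score X f q - 2 * f p q)"
    using mg[OF z0] by (simp add: g_def)
  ultimately show ?thesis by (rule that)
qed

text \<open>Two arcs with different score differences, both relabelled to run from \<open>p\<close>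
  to \<open>q\<close>, yield combinations with the same coefficient of \<open>arc p q\<close> but
  different coefficients of \<open>star_diff X p q\<close>; the latter term can then be
  eliminated.\<close>

lemma arc_multiple_in:
  assumes f: "f \<in> G"
    and sgn: "\<And>x y. x \<in> X \<Longrightarrow> y \<in> X \<Longrightarrow> x \<noteq> y \<Longrightarrow> f x y = 1 \<or> f x y = - 1"
    and X3: "card X \<ge> 3" and x0: "x0 \<in> X" "score X f x0 \<noteq> 0"
    and pq: "p \<in> X" "q \<in> X" "p \<noteq> q"
  obtains k where "k > 0" "(\<lambda>x y. k * arc p q x y) \<in> G"
proof -
  define m where "m = card X - 2"
  have ex: "\<exists>g. (\<lambda>x y. 2 * fact m * arc p q x y + g * star_diff X p q x y) \<in> G \<and>
      int m * g = fact m * (score X f a - score X f b - 2)"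
    if ab: "a \<in> X" "b \<in> X" "f a b = 1" for a b
  proof -
    have "a \<noteq> b" using ab skew_onD(3)[OF skew[OF f]] by fastforce
    then obtain \<sigma> where \<sigma>: "\<sigma> permutes X" "\<sigma> p = a" "\<sigma> q = b"
      using ex_permutes_pair[OF ab(1,2) _ pq] by blast
    \<comment> \<open>The relabelling puts the arc from \<open>a\<close> to \<open>b\<close> at
      \<open>(p, q)\<close> and carries the scores along.\<close>
    define f' where "f' x y = f (\<sigma> x) (\<sigma> y)" for x y
    have "f' \<in> G" unfolding f'_def by (rule perm_in[OF f \<sigma>(1)])
    moreover have "score X f' v = score X f (\<sigma> v)" for v
      unfolding score_def f'_def
      by (rule sum.reindex_bij_betw) (simp add: \<sigma> permutes_imp_bij)
    moreover have "f' p q = 1" by (simp add: f'_def \<sigma> ab)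
    ultimately show ?thesis
      using antisymmetrize_average[of f' p q] pq X3 \<sigma> unfolding m_def by auto
  qed
  obtain a b a' b' where arcs: "a \<in> X" "b \<in> X" "f a b = 1" "a' \<in> X" "b' \<in> X" "f a' b' = 1"
    and ne: "score X f a - score X f b \<noteq> score X f a' - score X f b'"
    using ex_arcs_score_diff[OF skew[OF f] sgn X3 x0] by blast
  obtain g where g: "(\<lambda>x y. 2 * fact m * arc p q x y + g * star_diff X p q x y) \<in> G"
      "int m * g = fact m * (score X f a - score X f b - 2)"
    using ex[OF arcs(1-3)] by blast
  obtain g' where g': "(\<lambda>x y. 2 * fact m * arc p q x y + g' * star_diff X p q x y) \<in> G"
      "int m * g' = fact m * (score X f a' - score X f b' - 2)"
    using ex[OF arcs(4-6)] by blast
  have "g \<noteq> g'" using g(2) g'(2) ne by auto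
  \<comment> \<open>The coefficient of \<open>arc p q\<close> left when \<open>g'\<close> times the
    first combination minus \<open>g\<close> times the second cancels the star terms.\<close>
  define k where "k = 2 * fact m * (g' - g)"
  have k0: "k \<noteq> 0" using \<open>g \<noteq> g'\<close> by (simp add: k_def)
  have "(\<lambda>x y. g' * (2 * fact m * arc p q x y + g * star_diff X p q x y) -
     g * (2 * fact m * arc p q x y + g' * star_diff X p q x y)) \<in> G"
    by (rule diff_in[OF int_mult_in[OF g(1)] int_mult_in[OF g'(1)]])
  also have "(\<lambda>x y. g' * (2 * fact m * arc p q x y + g * star_diff X p q x y) -
     g * (2 * fact m * arc p q x y + g' * star_diff X p q x y)) = (\<lambda>x y. k * arc p q x y)"
    by (simp add: k_def algebra_simps)
  finally have "(\<lambda>x y. k * arc p q x y) \<in> G" .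
  from int_mult_in[OF this, of "sgn k"] have "(\<lambda>x y. \<bar>k\<bar> * arc p q x y) \<in> G"
    by (simp add: mult.assoc[symmetric] abs_sgn mult.commute)
  with k0 show ?thesis by (intro that[of "\<bar>k\<bar>"]) simp_all
qed

text \<open>Add one positive multiple of an arc for each positive entry of \<open>t\<close>. By
  skew-symmetry \<open>(p, q)\<close> and \<open>(q, p)\<close> are never both used, so nothing
  cancels.\<close>

lemma ex_sign_pattern:
  assumes k: "\<And>p q. p \<in> X \<Longrightarrow> q \<in> X \<Longrightarrow> p \<noteq> q \<Longrightarrow> \<exists>k>0. (\<lambda>x y. k * arc p q x y) \<in> G"
    and t: "skew_on X t"
  obtains f where "f \<in> G" "\<And>x y. sgn (f x y) = sgn (t x y)"
proof -
  define P where "P = {(p, q). t p q > 0}"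
  have P: "p \<in> X \<and> q \<in> X \<and> p \<noteq> q" if "(p, q) \<in> P" for p q
    using that skew_onD(2)[OF t, of p q] skew_onD(3)[OF t, of p] by (auto simp: P_def)
  then have "P \<subseteq> X \<times> X" by auto
  then have "finite P" using finite_X by (simp add: finite_subset)
  have "\<forall>e\<in>P. \<exists>k>0. (\<lambda>x y. k * arc (fst e) (snd e) x y) \<in> G"
    using k P by auto
  from bchoice[OF this] obtain K
    where K: "\<forall>e\<in>P. K e > 0 \<and> (\<lambda>x y. K e * arc (fst e) (snd e) x y) \<in> G" ..
  define f where "f x y = (\<Sum>e\<in>P. K e * arc (fst e) (snd e) x y)" for x y
  have "f \<in> G" unfolding f_def
    by (rule sum_in[of P "\<lambda>e x y. K e * arc (fst e) (snd e) x y"]) (simp add: K)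
  moreover have "sgn (f x y) = sgn (t x y)" for x y
  proof -
    \<comment> \<open>Only the arcs \<open>(x, y)\<close> and \<open>(y, x)\<close> contribute to
      this entry.\<close>
    have "f x y = (\<Sum>e\<in>P. (if e = (x, y) then K e else 0) - (if e = (y, x) then K e else 0))"
      unfolding f_def
    proof (rule sum.cong[OF refl])
      fix e :: "'a \<times> 'a"
      obtain p q where e: "e = (p, q)" by (cases e)
      show "K e * arc (fst e) (snd e) x y =
          (if e = (x, y) then K e else 0) - (if e = (y, x) then K e else 0)"
        unfolding e arc_def fst_conv snd_conv prod.inject
        by (cases "x = p"; cases "y = q"; cases "x = q"; cases "y = p") simp_all
    qed
    also have "\<dots> = (if (x, y) \<in> P then K (x, y) else 0) - (if (y, x) \<in> P then K (y, x) else 0)"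
      using \<open>finite P\<close> by (simp add: sum_subtractf sum.delta)
    finally show ?thesis
      using bspec[OF K, of "(x, y)"] bspec[OF K, of "(y, x)"] skew_onD(1)[OF t, of y x] by (auto simp: P_def)
  qed
  ultimately show ?thesis by (rule that)
qed

end

section \<open>Sign matrices of choice functions\<close>

definition sign_matrix :: "'a set \<Rightarrow> ('a set \<Rightarrow> 'a) \<Rightarrow> 'a \<Rightarrow> 'a \<Rightarrow> int" where
  "sign_matrix X c x y =
    (if x \<in> X \<and> y \<in> X \<and> x \<noteq> y then if c {x, y} = y then 1 else - 1 else 0)"

text \<open>Lists allow a choice function to vote several times; their positions later serve as the
  index set \<open>J\<close>.\<close>

definition sign_sums :: "'a set \<Rightarrow> ('a set \<Rightarrow> 'a) set \<Rightarrow> ('a \<Rightarrow> 'a \<Rightarrow> int) set" where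
  "sign_sums X D = {f. \<exists>cs. set cs \<subseteq> D \<and> f = (\<lambda>x y. \<Sum>c\<leftarrow>cs. sign_matrix X c x y)}"

lemma skew_on_sign_matrix:
  assumes "c \<in> choice_functions X"
  shows "skew_on X (sign_matrix X c)"
proof -
  have "c {x, y} \<in> {x, y}" if "x \<in> X" "y \<in> X" "x \<noteq> y" for x y
  proof -
    have "{x, y} \<in> [X]\<^bsup>2\<^esup>" using that by (auto simp: nsets_def)
    then show ?thesis
      using assms PiE_mem[of c "[X]\<^bsup>2\<^esup>" "\<lambda>P. P" "{x, y}"] by (simp add: choice_functions_def)
  qed
  then have "sign_matrix X c x y + sign_matrix X c y x = 0" for x y
    by (force simp: sign_matrix_def insert_commute)
  then show ?thesis
    by (simp add: skew_on_def sign_matrix_def)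
qed

lemma sign_matrix_perm:
  assumes "\<pi> permutes X"
  shows "sign_matrix X (perm_choice X \<pi> c) (\<pi> x) (\<pi> y) = sign_matrix X c x y"
  using perm_choice_apply[OF assms, of x y c] permutes_in_image[OF assms] permutes_inj[OF assms]
  by (auto simp: sign_matrix_def inj_eq)

text \<open>A vote for \<open>y\<close> counts 1 and any other vote -1, so a strict majority for
  \<open>y\<close> means a positive sum.\<close>

lemma sum_sign_matrix:
  assumes "finite J" "x \<in> X" "y \<in> X" "x \<noteq> y"
  shows "(\<Sum>j\<in>J. sign_matrix X (d j) x y) = 2 * int (card {j \<in> J. d j {x, y} = y}) - int (card J)"
proof -
  have "(\<Sum>j\<in>J. sign_matrix X (d j) x y) = (\<Sum>j\<in>J. 2 * of_bool (d j {x, y} = y) - 1)"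
    using assms by (intro sum.cong) (auto simp: sign_matrix_def)
  also have "\<dots> = 2 * (\<Sum>j\<in>J. of_bool (d j {x, y} = y)) - int (card J)"
    by (simp add: sum_subtractf sum_distrib_left)
  also have "(\<Sum>j\<in>J. of_bool (d j {x, y} = y)) = int (card {j \<in> J. d j {x, y} = y})"
    using assms(1) by (simp add: Int_def)
  finally show ?thesis .
qed

lemma score_sign_matrix:
  assumes "finite X" "x \<in> X"
  shows "score X (sign_matrix X c) x = 2 * int (card {y \<in> X - {x}. c {x, y} = y}) - (int (card X) - 1)"
proof -
  have "score X (sign_matrix X c) x = (\<Sum>y\<in>X - {x}. sign_matrix X c x y)"
    unfolding score_def using assms by (intro sum.mono_neutral_right) (auto simp: sign_matrix_def)
  also have "\<dots> = (\<Sum>y\<in>X - {x}. 2 * of_bool (c {x, y} = y) - 1)"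
    using assms by (intro sum.cong) (auto simp: sign_matrix_def)
  also have "\<dots> = 2 * (\<Sum>y\<in>X - {x}. of_bool (c {x, y} = y)) - int (card (X - {x}))"
    by (simp add: sum_subtractf sum_distrib_left)
  also have "(\<Sum>y\<in>X - {x}. of_bool (c {x, y} = y)) = int (card {y \<in> X - {x}. c {x, y} = y})"
    using assms(1) by (simp add: Int_def)
  also have "int (card (X - {x})) = int (card X) - 1"
    using assms card_gt_0_iff[of X] by (auto simp: of_nat_diff Suc_leI)
  finally show ?thesis .
qed

text \<open>Translates the numerical condition in (B) into a nonzero score.\<close>

lemma score_sign_matrix_eq_0_iff:
  assumes "finite X" "x \<in> X"
  shows "score X (sign_matrix X c) x = 0 \<longleftrightarrow>
    real (card {y \<in> X - {x}. c {x, y} = y}) = (real (card X) - 1) / 2"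
  unfolding score_sign_matrix[OF assms] by (auto simp: field_simps)

section \<open>The invariant group of sums of sign matrices\<close>

lemma sign_sums_skew:
  assumes "D \<subseteq> choice_functions X" "f \<in> sign_sums X D"
  shows "skew_on X f"
proof -
  obtain cs where cs: "set cs \<subseteq> D" and f: "f = (\<lambda>x y. \<Sum>c\<leftarrow>cs. sign_matrix X c x y)"
    using assms(2) by (auto simp: sign_sums_def)
  have "set cs \<subseteq> choice_functions X" using cs assms(1) by blast
  then show ?thesis
    unfolding f by (induction cs) (simp_all add: skew_on_zero skew_on_add skew_on_sign_matrix)
qed

lemma sign_sums_zero: "(\<lambda>x y. 0) \<in> sign_sums X D"
  unfolding sign_sums_def by (intro CollectI exI[of _ "[]"]) simp

lemma sign_sums_single:
  assumes "c \<in> D"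
  shows "sign_matrix X c \<in> sign_sums X D"
  unfolding sign_sums_def using assms by (intro CollectI exI[of _ "[c]"]) simp

lemma sign_sums_add:
  assumes "f \<in> sign_sums X D" "g \<in> sign_sums X D"
  shows "(\<lambda>x y. f x y + g x y) \<in> sign_sums X D"
proof -
  obtain cs cs' where "set cs \<subseteq> D" "f = (\<lambda>x y. \<Sum>c\<leftarrow>cs. sign_matrix X c x y)"
      "set cs' \<subseteq> D" "g = (\<lambda>x y. \<Sum>c\<leftarrow>cs'. sign_matrix X c x y)"
    using assms by (auto simp: sign_sums_def)
  then show ?thesis
    unfolding sign_sums_def by (intro CollectI exI[of _ "cs @ cs'"]) simp
qed

lemma sign_sums_sum:
  assumes "\<And>i. i \<in> I \<Longrightarrow> F i \<in> sign_sums X D"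
  shows "(\<lambda>x y. \<Sum>i\<in>I. F i x y) \<in> sign_sums X D"
  using assms
  by (induction I rule: infinite_finite_induct) (simp_all add: sign_sums_zero sign_sums_add)

lemma sign_sums_perm:
  assumes D: "closed_under_permutations X D" and f: "f \<in> sign_sums X D" and \<pi>: "\<pi> permutes X"
  shows "(\<lambda>x y. f (\<pi> x) (\<pi> y)) \<in> sign_sums X D"
proof -
  obtain cs where cs: "set cs \<subseteq> D" and f_eq: "f = (\<lambda>x y. \<Sum>c\<leftarrow>cs. sign_matrix X c x y)"
    using f by (auto simp: sign_sums_def)
  \<comment> \<open>\<open>perm_choice\<close> moves matrix entries forward along the permutation,
    so pulling back along \<open>\<pi>\<close> takes the inverse.\<close>
  let ?cs = "map (perm_choice X (inv \<pi>)) cs"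
  have "sign_matrix X (perm_choice X (inv \<pi>) c) x y = sign_matrix X c (\<pi> x) (\<pi> y)" for c x y
    using sign_matrix_perm[OF permutes_inv[OF \<pi>], of c "\<pi> x" "\<pi> y"] permutes_inverses(2)[OF \<pi>]
    by simp
  then have "(\<lambda>x y. f (\<pi> x) (\<pi> y)) = (\<lambda>x y. \<Sum>c\<leftarrow>?cs. sign_matrix X c x y)"
    by (simp add: f_eq o_def)
  moreover have "set ?cs \<subseteq> D"
    using cs D permutes_inv[OF \<pi>] by (auto simp: closed_under_permutations_def)
  ultimately show ?thesis
    unfolding sign_sums_def by blast
qed

text \<open>Precomposing with the transposition of \<open>x\<close> and \<open>y\<close> only
  reorders the sum, but turns every term into its negative.\<close>

lemma sum_permutations_skew:
  assumes "skew_on X f" "x \<in> X" "y \<in> X"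
  shows "(\<Sum>\<pi> | \<pi> permutes X. f (\<pi> x) (\<pi> y)) = 0"
proof -
  have "(\<Sum>\<pi> | \<pi> permutes X. f (\<pi> x) (\<pi> y)) = (\<Sum>\<pi> | \<pi> permutes X. f (\<pi> y) (\<pi> x))"
    using sum_permutations_compose_right[OF permutes_swap_id[OF assms(2,3)],
        of "\<lambda>\<pi>. f (\<pi> x) (\<pi> y)"] by simp
  also have "\<dots> = (\<Sum>\<pi> | \<pi> permutes X. - f (\<pi> x) (\<pi> y))"
    by (intro sum.cong refl skew_onD(1)[OF assms(1)])
  finally show ?thesis by (simp add: sum_negf)
qed

text \<open>The images of \<open>f\<close> under all permutations sum to 0, so those under the
  permutations other than \<open>id\<close> sum to the negative of \<open>f\<close>. Closure under
  permutations thus makes a monoid into a group.\<close>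

lemma sign_sums_neg:
  assumes X: "finite X" and D: "D \<subseteq> choice_functions X" "closed_under_permutations X D"
    and f: "f \<in> sign_sums X D"
  shows "(\<lambda>x y. - f x y) \<in> sign_sums X D"
proof -
  have sk: "skew_on X f" by (rule sign_sums_skew[OF D(1) f])
  have "(\<lambda>x y. \<Sum>\<pi>\<in>{\<pi>. \<pi> permutes X} - {id}. f (\<pi> x) (\<pi> y)) \<in> sign_sums X D"
    by (intro sign_sums_sum sign_sums_perm[OF D(2) f]) simp
  moreover have "(\<Sum>\<pi>\<in>{\<pi>. \<pi> permutes X} - {id}. f (\<pi> x) (\<pi> y)) = - f x y" for x y
  proof (cases "x \<in> X \<and> y \<in> X")
    case True
    then show ?thesis
      using sum_permutations_skew[OF sk, of x y] finite_permutations[OF X]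
      by (simp add: sum_diff1 permutes_id)
  next
    case False
    then have "f (\<pi> x) (\<pi> y) = 0" if "\<pi> permutes X" for \<pi>
      using skew_onD(2)[OF sk] permutes_in_image[OF that] by blast
    then show ?thesis using False skew_onD(2)[OF sk, of x y] by auto
  qed
  ultimately show ?thesis by simp
qed

lemma invariant_group_sign_sums:
  assumes "finite X" "D \<subseteq> choice_functions X" "closed_under_permutations X D"
  shows "invariant_group X (sign_sums X D)"
  using assms sign_sums_skew sign_sums_neg sign_sums_perm
  by unfold_locales (auto intro: sign_sums_zero sign_sums_add)

section \<open>Majority votes and the equivalence of (A) and (B)\<close>

lemma majority_iff:
  "real (card J) / 2 < real k \<longleftrightarrow> 2 * int k - int (card J) > 0"
  by linarith

text \<open>Taking \<open>J\<close> among sets of natural numbers loses no generality, since every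
  finite set is in bijection with one of these.\<close>

theorem theorem0p1:
  fixes X :: "'a set" and D :: "('a set \<Rightarrow> 'a) set"
  assumes "finite X" and "card X \<ge> 3"
    and "D \<subseteq> choice_functions X" and "D \<noteq> {}"
    and "closed_under_permutations X D"
  shows "(\<forall>c\<in>choice_functions X. \<exists>(J :: nat set) d. finite J \<and> (\<forall>j\<in>J. d j \<in> D) \<and>
            (\<forall>x\<in>X. \<forall>y\<in>X. x \<noteq> y \<longrightarrow>
              (c {x, y} = y \<longleftrightarrow> real (card J) / 2 < real (card {j\<in>J. d j {x, y} = y}))))
     \<longleftrightarrow> (\<exists>c\<in>D. \<exists>x\<in>X. real (card {y \<in> X - {x}. c {x, y} = y}) \<noteq> (real (card X) - 1) / 2)"
    (is "?A \<longleftrightarrow> ?B")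
proof
  assume A: ?A
  show ?B
  proof (rule ccontr)
    assume "\<not> ?B"
    then have balanced: "score X (sign_matrix X c) x = 0" if "c \<in> D" "x \<in> X" for c x
      using that score_sign_matrix_eq_0_iff[OF assms(1)] by blast
    obtain x where x: "x \<in> X" using assms(2) by fastforce
    \<comment> \<open>This \<open>c\<close> never picks \<open>x\<close>, so realizing it by a
      majority makes every entry of the summed row at \<open>x\<close>, off the diagonal,
      positive.\<close>
    define c where "c = (\<lambda>P\<in>[X]\<^bsup>2\<^esup>. SOME y. y \<in> P \<and> y \<noteq> x)"
    have "(SOME y. y \<in> P \<and> y \<noteq> x) \<in> P" if "P \<in> [X]\<^bsup>2\<^esup>" for P
    proof -
      have "\<exists>y. y \<in> P \<and> y \<noteq> x" using that by (auto simp: nsets_def card_2_iff)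
      then show ?thesis by (metis (mono_tags, lifting) someI_ex)
    qed
    then have "c \<in> choice_functions X"
      unfolding choice_functions_def c_def by auto
    with A have "\<exists>(J :: nat set) d. finite J \<and> (\<forall>j\<in>J. d j \<in> D) \<and>
        (\<forall>x\<in>X. \<forall>y\<in>X. x \<noteq> y \<longrightarrow>
          (c {x, y} = y \<longleftrightarrow> real (card J) / 2 < real (card {j\<in>J. d j {x, y} = y})))"
      by (rule bspec)
    then obtain J :: "nat set" and d where J: "finite J" "\<forall>j\<in>J. d j \<in> D"
      and maj: "\<forall>x\<in>X. \<forall>y\<in>X. x \<noteq> y \<longrightarrow>
        (c {x, y} = y \<longleftrightarrow> real (card J) / 2 < real (card {j\<in>J. d j {x, y} = y}))"
      by (elim exE conjE)
    have pos: "(\<Sum>j\<in>J. sign_matrix X (d j) x y) > 0" if y: "y \<in> X - {x}" for y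
    proof -
      have "{x, y} \<in> [X]\<^bsup>2\<^esup>" using x y by (auto simp: nsets_def)
      moreover have "(SOME z. z \<in> {x, y} \<and> z \<noteq> x) = y"
        using y by (intro some_equality) auto
      ultimately have "c {x, y} = y" by (simp add: c_def)
      then have "real (card J) / 2 < real (card {j\<in>J. d j {x, y} = y})"
        using maj[rule_format, of x y] y x by (metis DiffD1 DiffD2 insertI1)
      then show ?thesis
        using sum_sign_matrix[OF J(1) x, of y d] y unfolding majority_iff by auto
    qed
    \<comment> \<open>That row sums to 0 because every \<open>d j\<close> is balanced at
      \<open>x\<close>, yet all its off-diagonal entries are positive.\<close>
    have "0 = (\<Sum>j\<in>J. score X (sign_matrix X (d j)) x)"
      using balanced J(2) x by simp
    also have "\<dots> = (\<Sum>y\<in>X. \<Sum>j\<in>J. sign_matrix X (d j) x y)"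
      unfolding score_def by (rule sum.swap)
    also have "\<dots> = (\<Sum>y\<in>X - {x}. \<Sum>j\<in>J. sign_matrix X (d j) x y)"
      using assms(1) by (intro sum.mono_neutral_right) (auto simp: sign_matrix_def)
    also have "\<dots> > 0"
    proof (rule sum_pos)
      show "X - {x} \<noteq> {}"
        using assms(2) card_mono[of "{x}" X] by auto
    qed (use assms(1) pos in auto)
    finally show False by simp
  qed
next
  assume ?B
  then obtain c0 x0 where c0: "c0 \<in> D" and x0: "x0 \<in> X" "score X (sign_matrix X c0) x0 \<noteq> 0"
    using score_sign_matrix_eq_0_iff[OF assms(1)] by blast
  interpret invariant_group X "sign_sums X D"
    by (rule invariant_group_sign_sums[OF assms(1,3,5)])
  have arcs: "\<exists>k>0. (\<lambda>x y. k * arc p q x y) \<in> sign_sums X D" if "p \<in> X" "q \<in> X" "p \<noteq> q" for p q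
    by (rule arc_multiple_in[OF sign_sums_single[OF c0] _ assms(2) x0 that])
      (auto simp: sign_matrix_def)
  show ?A
  proof
    fix c assume c: "c \<in> choice_functions X"
    obtain f where f: "f \<in> sign_sums X D" "\<And>x y. sgn (f x y) = sgn (sign_matrix X c x y)"
      using ex_sign_pattern[OF arcs skew_on_sign_matrix[OF c]] by blast
    obtain cs where cs: "set cs \<subseteq> D" "f = (\<lambda>x y. \<Sum>c\<leftarrow>cs. sign_matrix X c x y)"
      using f(1) by (auto simp: sign_sums_def)
    let ?J = "{..<length cs}"
    have "c {x, y} = y \<longleftrightarrow> real (card ?J) / 2 < real (card {j\<in>?J. (cs ! j) {x, y} = y})"
      if xy: "x \<in> X" "y \<in> X" "x \<noteq> y" for x y
    proof -
      have "f x y = (\<Sum>j\<in>?J. sign_matrix X (cs ! j) x y)"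
        by (simp add: cs(2) sum_list_sum_nth atLeast0LessThan)
      then have "(f x y > 0) = (real (card ?J) / 2 < real (card {j\<in>?J. (cs ! j) {x, y} = y}))"
        unfolding majority_iff using sum_sign_matrix[OF _ xy, of ?J "(!) cs"] by simp
      \<comment> \<open>Off the diagonal the entries of \<open>sign_matrix X c\<close> are 1 or -1,
        so ties do not occur.\<close>
      moreover have "f x y > 0 \<longleftrightarrow> c {x, y} = y"
        using f(2)[of x y] xy by (auto simp: sign_matrix_def sgn_if split: if_splits)
      ultimately show ?thesis by blast
    qed
    moreover have "\<forall>j\<in>?J. cs ! j \<in> D" using cs(1) by auto
    ultimately show "\<exists>(J :: nat set) d. finite J \<and> (\<forall>j\<in>J. d j \<in> D) \<and>
            (\<forall>x\<in>X. \<forall>y\<in>X. x \<noteq> y \<longrightarrow>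
              (c {x, y} = y \<longleftrightarrow> real (card J) / 2 < real (card {j\<in>J. d j {x, y} = y})))"
      by (intro exI[of _ ?J] exI[of _ "(!) cs"]) blast
  qed
qed

end
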